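(* Let $k\ge1$, $s\in\{1,\dots,k\}$, $h_{\max}\in\mathbb{R}$ and ${\bf x}_0,{\bf x}_T\in\mathbb{R}^k$, and let $(\bar{\bf x}(\cdot),\bar u(\cdot),\bar T)$ be an extremal of the time-optimal problem (P) described in the context. Put $$\Sigma=\{t\in[0,\bar T]:\ \bar x_s(t)=h_{\max}\},\qquad \Sigma_0=\{t\in\Sigma:\ \bar x_i(t)=0,\ i=s+1,\dots,k\}.$$ Let $t_i\in\Sigma$, $i=1,2,\dots$, with $t_i\to t_0$ as $i\to\infty$ and $t_i\neq t_j$ for $i\neq j$. Then $t_0\in\Sigma_0$.
   Context: Problem (P): minimize $T$ over triples $({\bf x}(\cdot),u(\cdot),T)$, $T>0$ free, where $u\in L_\infty([0,T];\mathbb{R})$, $|u(t)|\le 1$ for a.e. $t\in[0,T]$, ${\bf x}=(x_1,\dots,x_k):[0,T]\to\mathbb{R}^k$ is absolutely continuous, $\dot x_i=x_{i+1}$ for $i=1,\dots,k-1$, $\dot x_k=u$ (a.e.), ${\bf x}(0)={\bf x}_0$, ${\bf x}(T)={\bf x}_T$, and $x_s(t)\le h_{\max}$ for all $t\in[0,T]$. (The original problem has bounds $x_i(t)\in[h^i_{\min},h^i_{\max}]$ for all $i$; it is assumed that only $x_s\le h_{\max}=h^s_{\max}$ can be active, all other bounds being so large in absolute value that they are nowhere active, so they play no role.) Triples satisfying all these constraints are called feasible processes; the set of feasible processes is assumed non-empty. Standing assumption on the processes considered: $\bar x_s(0)<h_{\max}$ and $\bar x_s(\bar T)<h_{\max}$.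 Extremals: put $k_s=k-s+1$, and let $\mu^{(r)}$ denote the $r$-th derivative of $\mu$. A feasible process $(\bar{\bf x},\bar u,\bar T)$ is an extremal (satisfies the maximum principle) if there exist a number $\lambda\ge 0$, a Lipschitz function $\psi=(\psi_1,\dots,\psi_k):[0,\bar T]\to\mathbb{R}^k$, and a scalar function $\mu\in\mathbb{W}^{k-s}_\infty([0,\bar T];\mathbb{R})$ such that: (i) $\dot\psi_1=0$ and $\dot\psi_i=-\psi_{i-1}$ for $i=2,\dots,k$; (ii) $\max_{|v|\le 1}\bigl(\psi_k(t)+(-1)^{k_s}\mu(t)\bigr)v=\bigl(\psi_k(t)+(-1)^{k_s}\mu(t)\bigr)\bar u(t)$ for a.e. $t\in[0,\bar T]$; (iii) for all $t\in[0,\bar T]$, $$\sum_{i=1}^{k-1}\psi_i(t)\bar x_{i+1}(t)+\bigl|\psi_k(t)+(-1)^{k_s}\mu(t)\bigr|+\sum_{r=1}^{k-s}(-1)^r\mu^{(k_s-r)}(t)\,\bar x_{s+r}(t)=\lambda ;$$ (iv) $\mu^{(k-s)}$ is a decreasing (non-increasing) function, $\int_0^{\bar T}(\bar x_s(t)-h_{\max})\,d\mu^{(k-s)}(t)=0$, and $\mu(\bar T)=\mu^{(1)}(\bar T)=\dots=\mu^{(k-s)}(\bar T)=0$; (v) $\lambda+|\psi(0)|+\mu^{(k-s)}(0)>0$. Here $\mathbb{W}^{r}_\infty$ for $r>0$ is the space of functions whose derivative of order $r-1$ is absolutely continuous and whose derivative of order $r$ is bounded, and $\mathbb{W}^0_\infty=L_\infty$.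 (Since both endpoints are fixed, the transversality condition is vacuous. In (iii) the value of $\mu^{(k-s)}$ at a point of $\Sigma$ is immaterial when $s<k$, since $\bar x_{s+1}$ vanishes there.) *)

theory Defs
  imports "HOL-Analysis.Analysis"
begin

definition L_infty_on :: "real \<Rightarrow> real \<Rightarrow> (real \<Rightarrow> real) \<Rightarrow> bool" where
  "L_infty_on a b f \<longleftrightarrow>
     f \<in> borel_measurable (lebesgue_on {a..b}) \<and>
     (\<exists>C. AE t in lebesgue_on {a..b}. \<bar>f t\<bar> \<le> C)"

text \<open>The family \<open>d\<close> ranges over the finite families of non-overlapping compact subintervals of
  \<open>[a, b]\<close>. (The library constant \<open>absolutely_continuous\<close> concerns measures, not functions.)\<close>

definition abs_continuous_on :: "real \<Rightarrow> real \<Rightarrow> (real \<Rightarrow> real) \<Rightarrow> bool" where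
  "abs_continuous_on a b f \<longleftrightarrow>
     (\<forall>e>0. \<exists>\<delta>>0. \<forall>d S. d division_of S \<and> S \<subseteq> {a..b} \<and> (\<Sum>K\<in>d. Sup K - Inf K) < \<delta> \<longrightarrow>
        (\<Sum>K\<in>d. \<bar>f (Sup K) - f (Inf K)\<bar>) < e)"

text \<open>Membership \<open>f \<in> W\<^sup>r\<^sub>\<infinity>([a, b])\<close> together with a choice \<open>D j\<close> of the derivatives of \<open>f\<close>
  of order \<open>j \<le> r\<close>. Those of order \<open>j < r\<close> are determined by \<open>f\<close>; the one of order \<open>r\<close> is
  a pointwise representative, determined only almost everywhere if \<open>r > 0\<close>.
  For \<open>r = 0\<close> the space is \<open>L\<^sub>\<infinity>\<close>.\<close>

definition W_infty_derivs ::
  "nat \<Rightarrow> real \<Rightarrow> real \<Rightarrow> (real \<Rightarrow> real) \<Rightarrow> (nat \<Rightarrow> real \<Rightarrow> real) \<Rightarrow> bool" where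
  "W_infty_derivs r a b f D \<longleftrightarrow>
     (\<forall>t\<in>{a..b}. D 0 t = f t) \<and>
     (\<forall>j<r. abs_continuous_on a b (D j)) \<and>
     (\<forall>j. Suc j < r \<longrightarrow>
        (\<forall>t\<in>{a..b}. (D j has_real_derivative D (Suc j) t) (at t within {a..b}))) \<and>
     (\<forall>j. Suc j = r \<longrightarrow>
        (AE t in lebesgue_on {a..b}. (D j has_real_derivative D (Suc j) t) (at t within {a..b}))) \<and>
     L_infty_on a b (D r)"

text \<open>The Riemann--Stieltjes integral of \<open>f\<close> with respect to \<open>g\<close>, as the limit of the
  Riemann--Stieltjes sums when the mesh of the tagged division tends to \<open>0\<close>. For continuous \<open>f\<close>
  and monotone \<open>g\<close> it exists, jumps of \<open>g\<close> at \<open>a\<close> and \<open>b\<close> contribute to it, and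
  the values of \<open>g\<close> at its interior jump points do not matter.\<close>

definition has_Stieltjes_integral ::
  "(real \<Rightarrow> real) \<Rightarrow> (real \<Rightarrow> real) \<Rightarrow> real \<Rightarrow> real \<Rightarrow> real \<Rightarrow> bool" where
  "has_Stieltjes_integral f g a b I \<longleftrightarrow>
     (\<forall>e>0. \<exists>\<delta>>0. \<forall>p. p tagged_division_of {a..b} \<and> (\<lambda>\<xi>. ball \<xi> \<delta>) fine p \<longrightarrow>
        \<bar>(\<Sum>(\<xi>, K)\<in>p. f \<xi> * (g (Sup K) - g (Inf K))) - I\<bar> < e)"

text \<open>Vectors in \<open>\<real>\<^sup>k\<close> are represented by their components with indices \<open>1, \<dots>, k\<close>;
  values at other indices are irrelevant. Thus \<open>x i t\<close> is \<open>x\<^sub>i(t)\<close>.\<close>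

definition feasible_process ::
  "nat \<Rightarrow> nat \<Rightarrow> real \<Rightarrow> (nat \<Rightarrow> real) \<Rightarrow> (nat \<Rightarrow> real) \<Rightarrow>
   (nat \<Rightarrow> real \<Rightarrow> real) \<Rightarrow> (real \<Rightarrow> real) \<Rightarrow> real \<Rightarrow> bool" where
  "feasible_process k s hmax x0 xT x u T \<longleftrightarrow>
     T > 0 \<and>
     L_infty_on 0 T u \<and>
     (AE t in lebesgue_on {0..T}. \<bar>u t\<bar> \<le> 1) \<and>
     (\<forall>i\<in>{1..k}. abs_continuous_on 0 T (x i)) \<and>
     (\<forall>i\<in>{1..<k}. AE t in lebesgue_on {0..T}.
        (x i has_real_derivative x (Suc i) t) (at t within {0..T})) \<and>
     (AE t in lebesgue_on {0..T}. (x k has_real_derivative u t) (at t within {0..T})) \<and>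
     (\<forall>i\<in>{1..k}. x i 0 = x0 i \<and> x i T = xT i) \<and>
     (\<forall>t\<in>{0..T}. x s t \<le> hmax)"

text \<open>In the following definition \<open>D r\<close> is \<open>\<mu>\<^bsup>(r)\<^esup>\<close>; the representative of
  \<open>\<mu>\<^bsup>(k-s)\<^esup>\<close> is the non-increasing one. The exponent \<open>Suc (k - s)\<close> is \<open>k\<^sub>s\<close>.\<close>

definition extremal ::
  "nat \<Rightarrow> nat \<Rightarrow> real \<Rightarrow> (nat \<Rightarrow> real) \<Rightarrow> (nat \<Rightarrow> real) \<Rightarrow>
   (nat \<Rightarrow> real \<Rightarrow> real) \<Rightarrow> (real \<Rightarrow> real) \<Rightarrow> real \<Rightarrow> bool" where
  "extremal k s hmax x0 xT x u T \<longleftrightarrow>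
     feasible_process k s hmax x0 xT x u T \<and>
     (\<exists>(lam :: real) (\<psi> :: nat \<Rightarrow> real \<Rightarrow> real) (\<mu> :: real \<Rightarrow> real) (D :: nat \<Rightarrow> real \<Rightarrow> real).
        lam \<ge> 0 \<and>
        (\<forall>i\<in>{1..k}. \<exists>L. L-lipschitz_on {0..T} (\<psi> i)) \<and>
        W_infty_derivs (k - s) 0 T \<mu> D \<and>
        (AE t in lebesgue_on {0..T}. (\<psi> 1 has_real_derivative 0) (at t within {0..T})) \<and>
        (\<forall>i\<in>{2..k}. AE t in lebesgue_on {0..T}.
           (\<psi> i has_real_derivative - \<psi> (i - 1) t) (at t within {0..T})) \<and>
        (AE t in lebesgue_on {0..T}.
           (SUP v\<in>{-1..1}. (\<psi> k t + (-1) ^ Suc (k - s) * \<mu> t) * v)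
             = (\<psi> k t + (-1) ^ Suc (k - s) * \<mu> t) * u t) \<and>
        (\<forall>t\<in>{0..T}.
           (\<Sum>i=1..k - 1. \<psi> i t * x (Suc i) t)
             + \<bar>\<psi> k t + (-1) ^ Suc (k - s) * \<mu> t\<bar>
             + (\<Sum>r=1..k - s. (-1) ^ r * D (Suc (k - s) - r) t * x (s + r) t) = lam) \<and>
        antimono_on {0..T} (D (k - s)) \<and>
        has_Stieltjes_integral (\<lambda>t. x s t - hmax) (D (k - s)) 0 T 0 \<and>
        (\<forall>r\<le>k - s. D r T = 0) \<and>
        lam + L2_set (\<lambda>i. \<psi> i 0) {1..k} + D (k - s) 0 > 0)"

definition contact_set :: "nat \<Rightarrow> real \<Rightarrow> (nat \<Rightarrow> real \<Rightarrow> real) \<Rightarrow> real \<Rightarrow> real set" where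
  "contact_set s hmax x T = {t \<in> {0..T}. x s t = hmax}"

definition contact_set0 :: "nat \<Rightarrow> nat \<Rightarrow> real \<Rightarrow> (nat \<Rightarrow> real \<Rightarrow> real) \<Rightarrow> real \<Rightarrow> real set" where
  "contact_set0 k s hmax x T = {t \<in> contact_set s hmax x T. \<forall>i\<in>{s + 1..k}. x i t = 0}"

end

theory Submission
  imports Defs
begin

text \<open>Since \<open>x\<^sub>s\<close> is of class \<open>C\<^bsup>k-s\<^esup>\<close> with derivatives \<open>x\<^bsub>s+1\<^esub>, \<dots>, x\<^sub>k\<close>, Rolle's theorem
  turns an accumulation point of zeros of one derivative into an accumulation point of zeros of
  the next one, and by continuity all of them vanish there.
  The regularity of the components follows from the fundamental theorem of calculus for
  absolutely continuous functions.\<close>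

section \<open>Absolute continuity on an interval\<close>

lemma abs_continuous_on_subset:
  assumes "abs_continuous_on a b f" and "a \<le> c" and "d \<le> b"
  shows "abs_continuous_on c d f"
proof -
  have "S \<subseteq> {a..b}" if "S \<subseteq> {c..d}" for S
    using that assms by force
  then show ?thesis
    using assms(1) unfolding abs_continuous_on_def by meson
qed

lemma abs_continuous_on_imp_continuous_on:
  assumes "abs_continuous_on a b f"
  shows "continuous_on {a..b} f"
  unfolding continuous_on_iff
proof (intro ballI allI impI)
  fix t e :: real
  assume t: "t \<in> {a..b}" and "e > 0"
  then obtain \<delta> where "\<delta> > 0"
    and \<delta>: "\<And>d S. d division_of S \<and> S \<subseteq> {a..b} \<and> (\<Sum>K\<in>d. Sup K - Inf K) < \<delta>
      \<Longrightarrow> (\<Sum>K\<in>d. \<bar>f (Sup K) - f (Inf K)\<bar>) < e"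
    using assms unfolding abs_continuous_on_def by metis
  \<comment> \<open>A single interval is already a division, so absolute continuity applied to it
    alone gives uniform continuity.\<close>
  have close: "\<bar>f v - f w\<bar> < e" if "w \<in> {a..b}" "v \<in> {a..b}" "w \<le> v" "v - w < \<delta>" for v w
  proof -
    have "{cbox w v} division_of cbox w v"
      using that by (intro division_of_self) auto
    then show ?thesis
      using \<delta>[of "{cbox w v}" "cbox w v"] that by auto
  qed
  have "dist (f v) (f t) < e" if "v \<in> {a..b}" "dist v t < \<delta>" for v
    using close[of t v] close[of v t] that t by (cases "v \<le> t") (auto simp: dist_real_def)
  then show "\<exists>\<delta>>0. \<forall>v\<in>{a..b}. dist v t < \<delta> \<longrightarrow> dist (f v) (f t) < e"
    using \<open>\<delta> > 0\<close> by blast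
qed

section \<open>The fundamental theorem of calculus for absolutely continuous functions\<close>

lemma AE_lebesgue_on_imp_negligible:
  assumes "AE t in lebesgue_on S. P t" and "S \<in> sets lebesgue"
  shows "negligible {t \<in> S. \<not> P t}"
proof -
  have "AE t in lebesgue. t \<in> S \<longrightarrow> P t"
    using assms by (simp add: AE_restrict_space_iff)
  then obtain N where "N \<in> null_sets lebesgue" "{t. \<not> (t \<in> S \<longrightarrow> P t)} \<subseteq> N"
    by (auto simp: eventually_ae_filter)
  then show ?thesis
    by (auto simp: negligible_iff_null_sets[symmetric] intro: negligible_subset)
qed

text \<open>Because the tag lies between the endpoints, the two errors of the linear approximation
  add up to a multiple of \<open>v - u\<close> itself.\<close>

lemma straddle_bound:
  fixes f :: "real \<Rightarrow> real"
  assumes "u \<le> t" and "t \<le> v"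
    and "\<bar>f u - f t - (u - t) * m\<bar> \<le> e * \<bar>u - t\<bar>"
    and "\<bar>f v - f t - (v - t) * m\<bar> \<le> e * \<bar>v - t\<bar>"
  shows "\<bar>(v - u) * m - (f v - f u)\<bar> \<le> e * (v - u)"
proof -
  have "\<bar>(v - u) * m - (f v - f u)\<bar> =
      \<bar>(f u - f t - (u - t) * m) - (f v - f t - (v - t) * m)\<bar>"
    by (auto simp: algebra_simps)
  also have "\<dots> \<le> e * \<bar>u - t\<bar> + e * \<bar>v - t\<bar>"
    using assms by linarith
  also have "\<dots> = e * (v - u)"
    using assms(1,2) by (simp add: algebra_simps)
  finally show ?thesis .
qed

text \<open>The tags in the exceptional null set are charged to absolute continuity, inside an open
  set of small measure; at the other tags the derivative controls the increments.\<close>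

lemma abs_continuous_on_has_integral_derivative:
  assumes "a \<le> b" and ac: "abs_continuous_on a b f" and N: "negligible N"
    and der: "\<And>t. t \<in> {a..b} - N \<Longrightarrow> (f has_real_derivative g t) (at t within {a..b})"
  shows "(g has_integral (f b - f a)) {a..b}"
proof -
  \<comment> \<open>Setting the integrand to 0 on \<open>N\<close> leaves only an increment of
    \<open>f\<close> at each tag in \<open>N\<close>; the final spike argument restores
    \<open>g\<close>.\<close>
  define h where "h t = (if t \<in> N then 0 else g t)" for t
  have "(h has_integral (f b - f a)) {a..b}"
    unfolding has_integral_real
  proof (intro allI impI)
    fix e :: real
    assume "e > 0"
    then have "e / 2 > 0" by simp
    with ac obtain \<delta> where "\<delta> > 0"
      and \<delta>: "\<And>d S. d division_of S \<and> S \<subseteq> {a..b} \<and> (\<Sum>K\<in>d. Sup K - Inf K) < \<delta>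
        \<Longrightarrow> (\<Sum>K\<in>d. \<bar>f (Sup K) - f (Inf K)\<bar>) < e / 2"
      unfolding abs_continuous_on_def by metis
    have Nnull: "N \<in> null_sets lebesgue"
      using N by (simp add: negligible_iff_null_sets)
    obtain U where "open U" "N \<subseteq> U" and UN: "U - N \<in> lmeasurable"
      and emU: "emeasure lebesgue (U - N) < ennreal \<delta>"
      using sets_lebesgue_outer_open[of N \<delta>] Nnull \<open>\<delta> > 0\<close> by blast
    have U: "U \<in> lmeasurable"
    proof -
      have "(U - N) \<union> N \<in> lmeasurable"
        using UN N negligible_imp_measurable by blast
      then show ?thesis using \<open>N \<subseteq> U\<close> by (simp add: Un_absorb2)
    qed
    have "emeasure lebesgue U = emeasure lebesgue (U - N)"
      using emeasure_Diff_null_set[OF Nnull] U by (simp add: fmeasurableD)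
    then have mU: "measure lebesgue U < \<delta>"
      using emU U by (metis emeasure_eq_measure2 ennreal_less_iff measure_nonneg)
    \<comment> \<open>The good tags will contribute at most \<open>\<epsilon> * (b - a)\<close>. The
      summand 1 avoids division by zero when \<open>a = b\<close> and makes the bound by
      \<open>e / 2\<close> strict.\<close>
    define \<epsilon> where "\<epsilon> = e / (2 * (b - a + 1))"
    have "\<epsilon> > 0" and \<epsilon>: "\<epsilon> * (b - a) < e / 2"
      using \<open>e > 0\<close> \<open>a \<le> b\<close> by (auto simp: \<epsilon>_def field_simps)
    \<comment> \<open>One radius function serves both kinds of tags: balls around points of
      \<open>N\<close> stay inside \<open>U\<close>, the others are small enough for the linear
      approximation.\<close>
    have "\<exists>r>0. (t \<in> N \<longrightarrow> ball t r \<subseteq> U) \<and> (t \<in> {a..b} - N \<longrightarrow>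
       (\<forall>y\<in>{a..b}. \<bar>y - t\<bar> < r \<longrightarrow> \<bar>f y - f t - (y - t) * g t\<bar> \<le> \<epsilon> * \<bar>y - t\<bar>))" for t
    proof (cases "t \<in> N")
      case True
      then show ?thesis
        using \<open>open U\<close> \<open>N \<subseteq> U\<close> by (meson DiffD2 openE subsetD)
    next
      case False
      have "\<exists>r>0. \<forall>y\<in>{a..b}. \<bar>y - t\<bar> < r \<longrightarrow> \<bar>f y - f t - (y - t) * g t\<bar> \<le> \<epsilon> * \<bar>y - t\<bar>"
        if "t \<in> {a..b}"
        using der[of t] that False \<open>\<epsilon> > 0\<close>
        unfolding has_field_derivative_def has_derivative_within_alt
        by (simp add: mult.commute)
      then show ?thesis
        using False zero_less_one by blast
    qed
    then obtain r where r: "\<And>t. r t > 0" and rN: "\<And>t. t \<in> N \<Longrightarrow> ball t (r t) \<subseteq> U"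
      and rg: "\<And>t y. t \<in> {a..b} - N \<Longrightarrow> y \<in> {a..b} \<Longrightarrow> \<bar>y - t\<bar> < r t
        \<Longrightarrow> \<bar>f y - f t - (y - t) * g t\<bar> \<le> \<epsilon> * \<bar>y - t\<bar>"
      by metis
    show "\<exists>\<gamma>. gauge \<gamma> \<and> (\<forall>\<D>. \<D> tagged_division_of {a..b} \<and> \<gamma> fine \<D> \<longrightarrow>
        norm ((\<Sum>(t, K)\<in>\<D>. measure lborel K *\<^sub>R h t) - (f b - f a)) < e)"
    proof (intro exI[of _ "\<lambda>t. ball t (r t)"] conjI allI impI)
      show "gauge (\<lambda>t. ball t (r t))"
        using r gauge_ball_dependent by blast
    next
      fix p
      assume "p tagged_division_of {a..b} \<and> (\<lambda>t. ball t (r t)) fine p"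
      then have p: "p tagged_division_of {a..b}" and fine: "(\<lambda>t. ball t (r t)) fine p"
        by auto
      have fin: "finite p"
        using p by blast
      have mem: "\<exists>u v. K = {u..v} \<and> u \<le> t \<and> t \<le> v \<and> {u..v} \<subseteq> {a..b} \<and> {u..v} \<subseteq> ball t (r t)"
        if "(t, K) \<in> p" for t K
      proof -
        have "t \<in> K" "K \<subseteq> {a..b}" "\<exists>u v. K = {u..v}"
          using tagged_division_ofD(2-4)[OF p that] by auto
        moreover have "K \<subseteq> ball t (r t)"
          using fine that by (auto simp: fine_def)
        ultimately show ?thesis
          by auto
      qed
      define q where "q = {y \<in> p. fst y \<in> N}"
      have "q \<subseteq> p"
        by (auto simp: q_def)
      have "q tagged_partial_division_of {a..b}"
        using tagged_partial_division_subset[OF _ \<open>q \<subseteq> p\<close>] p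
        by (simp add: tagged_division_of_def)
      then have tag: "q tagged_division_of \<Union>(snd ` q)"
        by (rule tagged_partial_division_of_Union_self)
      then have div: "snd ` q division_of \<Union>(snd ` q)"
        by (rule division_of_tagged_division)
      have "K \<subseteq> {a..b}" "K \<subseteq> U" if "(t, K) \<in> q" for t K
        using that mem[of t K] rN[of t] by (auto simp: q_def)
      then have sub: "\<Union>(snd ` q) \<subseteq> {a..b}" and subU: "\<Union>(snd ` q) \<subseteq> U"
        by (force, force)
      \<comment> \<open>The intervals with tags in \<open>N\<close> do not overlap and lie in
        \<open>U\<close>, so their total length is below \<delta> and absolute continuity applies to
        them.\<close>
      have "(\<Sum>K\<in>snd ` q. Sup K - Inf K) = (\<Sum>K\<in>snd ` q. measure lebesgue K)"
      proof (rule sum.cong)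
        fix K assume "K \<in> snd ` q"
        then obtain t where "(t, K) \<in> p"
          by (auto simp: q_def)
        then obtain u v where "K = {u..v}" "u \<le> v"
          using mem[of t K] by auto
        then show "Sup K - Inf K = measure lebesgue K"
          by simp
      qed simp
      also have "\<dots> = measure lebesgue (\<Union>(snd ` q))"
        by (rule content_division[OF div])
      also have "\<dots> \<le> measure lebesgue U"
        using U subU lmeasurable_division[OF div] by (intro measure_mono_fmeasurable) auto
      finally have "(\<Sum>K\<in>snd ` q. Sup K - Inf K) < \<delta>"
        using mU by simp
      then have "(\<Sum>K\<in>snd ` q. \<bar>f (Sup K) - f (Inf K)\<bar>) < e / 2"
        using \<delta>[of "snd ` q" "\<Union>(snd ` q)"] div sub by linarith
      \<comment> \<open>Different tags can share an interval only if it is degenerate, and then the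
        increment of \<open>f\<close> is 0. So summing over tagged pairs or over intervals makes no
        difference.\<close>
      moreover have "(\<Sum>(t, K)\<in>q. \<bar>f (Sup K) - f (Inf K)\<bar>)
          = (\<Sum>K\<in>snd ` q. \<bar>f (Sup K) - f (Inf K)\<bar>)"
      proof -
        \<comment> \<open>The empty interval gets the value 0 explicitly: the summation lemma also
          covers empty \<open>cbox u v\<close>, where \<open>Sup\<close> and \<open>Inf\<close>
          carry no information.\<close>
        define d where "d K = (if K = {} then 0 else \<bar>f (Sup K) - f (Inf K)\<bar>)" for K
        have "(\<Sum>(t, K)\<in>q. d K) = sum d (snd ` q)"
        proof (rule sum.over_tagged_division_lemma[OF tag])
          fix u v :: real
          assume "box u v = {}"
          then show "d (cbox u v) = 0"
            by (cases "u = v") (auto simp: d_def)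
        qed
        moreover have d: "d K = \<bar>f (Sup K) - f (Inf K)\<bar>" if "(t, K) \<in> q" for t K
          using that mem[of t K] by (auto simp: d_def q_def)
        moreover have "(\<Sum>(t, K)\<in>q. d K) = (\<Sum>(t, K)\<in>q. \<bar>f (Sup K) - f (Inf K)\<bar>)"
          by (rule sum.cong) (use d in auto)
        moreover have "sum d (snd ` q) = (\<Sum>K\<in>snd ` q. \<bar>f (Sup K) - f (Inf K)\<bar>)"
          by (rule sum.cong) (use d in auto)
        ultimately show ?thesis
          by simp
      qed
      ultimately have bad: "(\<Sum>(t, K)\<in>q. \<bar>f (Sup K) - f (Inf K)\<bar>) < e / 2"
        by simp
      have "\<bar>(\<Sum>(t, K)\<in>p. measure lborel K * h t) - (f b - f a)\<bar>
          = \<bar>\<Sum>(t, K)\<in>p. measure lborel K * h t - (f (Sup K) - f (Inf K))\<bar>"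
        using additive_tagged_division_1[OF \<open>a \<le> b\<close> p, of f] by (simp add: split_def sum_subtractf)
      also have "\<dots> \<le> (\<Sum>(t, K)\<in>p. \<bar>measure lborel K * h t - (f (Sup K) - f (Inf K))\<bar>)"
        by (simp add: split_def)
      \<comment> \<open>A tag outside \<open>N\<close> costs the straddle bound, a tag in
        \<open>N\<close> the whole increment of \<open>f\<close>; each of the two totals stays below
        \<open>e / 2\<close>.\<close>
      also have "\<dots> \<le> (\<Sum>(t, K)\<in>p. \<epsilon> * (Sup K - Inf K)
          + (if t \<in> N then \<bar>f (Sup K) - f (Inf K)\<bar> else 0))"
      proof (rule sum_mono, clarify)
        fix t K
        assume "(t, K) \<in> p"
        then obtain u v where K: "K = {u..v}" and uv: "u \<le> t" "t \<le> v" "{u..v} \<subseteq> {a..b}"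
          "{u..v} \<subseteq> ball t (r t)"
          using mem[of t K] by auto
        have "{u, t, v} \<subseteq> {u..v}"
          using uv by auto
        with uv have "{u, t, v} \<subseteq> {a..b}" "{u, t, v} \<subseteq> ball t (r t)"
          by (blast intro: order_trans)+
        then have near: "u \<in> {a..b}" "v \<in> {a..b}" "t \<in> {a..b}" "\<bar>u - t\<bar> < r t" "\<bar>v - t\<bar> < r t"
          by (auto simp: dist_real_def)
        show "\<bar>measure lborel K * h t - (f (Sup K) - f (Inf K))\<bar> \<le> \<epsilon> * (Sup K - Inf K)
          + (if t \<in> N then \<bar>f (Sup K) - f (Inf K)\<bar> else 0)"
        proof (cases "t \<in> N")
          case True
          then show ?thesis
            using K uv \<open>\<epsilon> > 0\<close> by (simp add: h_def abs_minus_commute)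
        next
          case False
          then have "\<bar>(v - u) * g t - (f v - f u)\<bar> \<le> \<epsilon> * (v - u)"
            using near uv by (intro straddle_bound[of u t v] rg) auto
          then show ?thesis
            using K uv False by (simp add: h_def)
        qed
      qed
      also have "\<dots> = \<epsilon> * (\<Sum>(t, K)\<in>p. Sup K - Inf K)
          + (\<Sum>(t, K)\<in>q. \<bar>f (Sup K) - f (Inf K)\<bar>)"
      proof -
        have "(\<Sum>y\<in>q. \<bar>f (Sup (snd y)) - f (Inf (snd y))\<bar>)
            = (\<Sum>y\<in>p. if fst y \<in> N then \<bar>f (Sup (snd y)) - f (Inf (snd y))\<bar> else 0)"
          unfolding q_def using fin by (rule sum.inter_filter)
        then show ?thesis
          by (simp add: split_def sum.distrib sum_distrib_left)
      qed
      also have "(\<Sum>(t, K)\<in>p. Sup K - Inf K) = b - a"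
        using additive_tagged_division_1[OF \<open>a \<le> b\<close> p, of "\<lambda>t. t"] by simp
      finally show "norm ((\<Sum>(t, K)\<in>p. measure lborel K *\<^sub>R h t) - (f b - f a)) < e"
        using bad \<epsilon> by simp
    qed
  qed
  then show ?thesis
    by (rule has_integral_spike[OF N, rotated]) (simp add: h_def)
qed

text \<open>On every \<open>{a..c}\<close> the function \<open>f\<close> is recovered by integrating
  \<open>g\<close>. The indefinite integral of a continuous function is differentiable at every
  point, which removes the exceptional null set.\<close>

lemma abs_continuous_on_has_real_derivative:
  assumes ac: "abs_continuous_on a b f" and g: "continuous_on {a..b} g"
    and ae: "AE t in lebesgue_on {a..b}. (f has_real_derivative g t) (at t within {a..b})"
    and t: "t \<in> {a..b}"
  shows "(f has_real_derivative g t) (at t within {a..b})"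
proof -
  have eq: "f a + integral {a..c} g = f c" if "c \<in> {a..b}" for c
  proof -
    have "(g has_integral (f c - f a)) {a..c}"
    proof (rule abs_continuous_on_has_integral_derivative)
      show "negligible {t \<in> {a..b}. \<not> (f has_real_derivative g t) (at t within {a..b})}"
        using ae by (rule AE_lebesgue_on_imp_negligible) simp
      show "abs_continuous_on a c f"
        by (rule abs_continuous_on_subset[OF ac]) (use that in auto)
      show "(f has_real_derivative g v) (at v within {a..c})"
        if "v \<in> {a..c} - {t \<in> {a..b}. \<not> (f has_real_derivative g t) (at t within {a..b})}" for v
      proof (rule DERIV_subset)
        show "(f has_real_derivative g v) (at v within {a..b})" "{a..c} \<subseteq> {a..b}"
          using that \<open>c \<in> {a..b}\<close> by auto
      qed
    qed (use that in simp)
    then show ?thesis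
      by (simp add: integral_unique)
  qed
  have "((\<lambda>c. f a + integral {a..c} g) has_real_derivative g t) (at t within {a..b})"
    using integral_has_real_derivative[OF g t] by (auto intro!: derivative_eq_intros)
  then show ?thesis
    using zero_less_one t eq by (rule has_field_derivative_transform_within)
qed

section \<open>Accumulation points of level sets\<close>

lemma islimpt_level_set_imp_mem:
  fixes f :: "real \<Rightarrow> real"
  assumes "continuous_on {a..b} f" and "p islimpt {t \<in> {a..b}. f t = c}"
  shows "p \<in> {a..b}" and "f p = c"
proof -
  have "closed {t \<in> {a..b}. f t = c}"
    using assms(1) by (rule continuous_closed_preimage_constant) simp
  then have "p \<in> {t \<in> {a..b}. f t = c}"
    using assms(2) unfolding closed_limpt by blast
  then show "p \<in> {a..b}" "f p = c"
    by simp_all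
qed

text \<open>By continuity \<open>p\<close> lies in the level set itself. Rolle's theorem between
  \<open>p\<close> and a nearby point of that set yields a zero of \<open>g\<close> strictly between
  them, hence close to \<open>p\<close> but different from it.\<close>

lemma islimpt_level_set_derivative:
  fixes f g :: "real \<Rightarrow> real"
  assumes der: "\<And>t. t \<in> {a..b} \<Longrightarrow> (f has_real_derivative g t) (at t within {a..b})"
    and lim: "p islimpt {t \<in> {a..b}. f t = c}"
  shows "p islimpt {t \<in> {a..b}. g t = 0}"
  unfolding islimpt_approachable
proof (intro allI impI)
  fix e :: real
  assume "e > 0"
  have cont: "continuous_on {a..b} f"
    using der DERIV_continuous continuous_on_eq_continuous_within by blast
  note p = islimpt_level_set_imp_mem[OF cont lim]
  obtain v where v: "v \<in> {a..b}" "f v = c" "v \<noteq> p" "dist v p < e"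
    using lim \<open>e > 0\<close> unfolding islimpt_approachable by blast
  let ?l = "min p v" and ?r = "max p v"
  have "\<exists>z. ?l < z \<and> z < ?r \<and> (\<lambda>y. g z * y) = (\<lambda>y. 0)"
  proof (rule Rolle_deriv[where f = f])
    show "continuous_on {?l..?r} f"
      using cont by (rule continuous_on_subset) (use p v in auto)
    show "(f has_derivative (\<lambda>y. g z * y)) (at z)" if "?l < z" "z < ?r" for z
    proof -
      have "z \<in> {a<..<b}"
        using that p v by auto
      then show ?thesis
        using der[of z] by (simp add: at_within_Icc_at has_field_derivative_def)
    qed
  qed (use p v in \<open>auto simp: min_def max_def\<close>)
  then obtain z where z: "?l < z" "z < ?r" and "(\<lambda>y. g z * y) = (\<lambda>y. 0)"
    by blast
  \<comment> \<open>The vanishing linear map is evaluated at 1.\<close>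
  then have "g z = 0"
    by (metis mult.right_neutral)
  then show "\<exists>z\<in>{t \<in> {a..b}. g t = 0}. z \<noteq> p \<and> dist z p < e"
    using z p v by (intro bexI[of _ z]) (auto simp: dist_real_def min_def max_def split: if_splits)
qed

lemma islimpt_range_of_inj:
  fixes t :: "nat \<Rightarrow> 'a::metric_space"
  assumes "inj t" and "t \<longlonglongrightarrow> p"
  shows "p islimpt range t"
  unfolding islimpt_approachable
proof (intro allI impI)
  fix e :: real
  assume "e > 0"
  then obtain n where n: "\<And>m. m \<ge> n \<Longrightarrow> dist (t m) p < e"
    using assms(2) by (meson metric_LIMSEQ_D)
  \<comment> \<open>An injective sequence takes the value \<open>p\<close> at most once, so one of
    two consecutive terms differs from it.\<close>
  have "t n \<noteq> p \<or> t (Suc n) \<noteq> p"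
    using assms(1) by (metis injD n_not_Suc_n)
  then show "\<exists>y\<in>range t. y \<noteq> p \<and> dist y p < e"
    using n by (meson le_SucI order_refl rangeI)
qed

section \<open>Application to the chain of state components\<close>

theorem proposition2:
  fixes k s :: nat and hmax T t0 :: real
    and x0 xT :: "nat \<Rightarrow> real" and x :: "nat \<Rightarrow> real \<Rightarrow> real"
    and u :: "real \<Rightarrow> real" and t :: "nat \<Rightarrow> real"
  assumes "k \<ge> 1" and "s \<in> {1..k}"
    and "extremal k s hmax x0 xT x u T"
    and "x s 0 < hmax" and "x s T < hmax"
    and "\<And>i. t i \<in> contact_set s hmax x T"
    and "t \<longlonglongrightarrow> t0"
    and "\<And>i j. i \<noteq> j \<Longrightarrow> t i \<noteq> t j"
  shows "t0 \<in> contact_set0 k s hmax x T"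
proof -
  have feas: "feasible_process k s hmax x0 xT x u T"
    using assms(3) by (simp add: extremal_def)
  then have ac: "abs_continuous_on 0 T (x i)" if "i \<in> {1..k}" for i
    using that by (simp add: feasible_process_def)
  then have cont: "continuous_on {0..T} (x i)" if "i \<in> {1..k}" for i
    using that abs_continuous_on_imp_continuous_on by blast
  \<comment> \<open>Feasibility gives these derivatives only almost everywhere, but for
    \<open>i < k\<close> the derivative \<open>x (Suc i)\<close> is continuous. The index
    \<open>k\<close> is left out since the control \<open>u\<close> may jump; \<open>x k\<close> is
    still reached as the derivative of \<open>x (k - 1)\<close> when \<open>s < k\<close>.\<close>
  have der: "(x i has_real_derivative x (Suc i) c) (at c within {0..T})"
    if "i \<in> {1..<k}" "c \<in> {0..T}" for i c
    using that ac cont feas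
    by (intro abs_continuous_on_has_real_derivative) (auto simp: feasible_process_def)
  have "inj t"
    using assms(8) by (meson injI)
  then have "t0 islimpt range t"
    using assms(7) by (rule islimpt_range_of_inj)
  then have contact: "t0 islimpt {c \<in> {0..T}. x s c = hmax}"
    by (rule islimpt_subset) (use assms(6) in \<open>auto simp: contact_set_def\<close>)
  \<comment> \<open>The first Rolle step starts from the level \<open>hmax\<close> of
    \<open>x s\<close>, all later ones from level 0. For \<open>s = k\<close> the range of indices
    is empty.\<close>
  have zeros: "t0 islimpt {c \<in> {0..T}. x i c = 0}" if "Suc s \<le> i" "i \<le> k" for i
    using that
  proof (induction i rule: dec_induct)
    case base
    show ?case
      using der[of s] base assms(2) by (intro islimpt_level_set_derivative[OF _ contact]) auto
  next
    case (step i)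
    show ?case
      using der[of i] step by (intro islimpt_level_set_derivative[where f = "x i"]) auto
  qed
  show ?thesis
    using islimpt_level_set_imp_mem[OF cont contact] islimpt_level_set_imp_mem[OF cont zeros]
      assms(2)
    by (auto simp: contact_set0_def contact_set_def)
qed

end
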